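(* There are absolute constants $c, C>0$ such that for every integer $d \geq 4$ there exists a set $\mathcal{H}$ of hyperplanes in $\mathbb{R}^d$ with $$c\, d^2 \log d \;\leq\; \operatorname{vcdim}\left(\Delta(\mathcal{H})\right) \;\leq\; C\, d^2\log d,$$ i.e. $\operatorname{vcdim}(\Delta(\mathcal{H})) = \Theta(d^2 \log d)$.
   Context: For a set $\mathcal{H}$ of hyperplanes in $\mathbb{R}^d$, define the set system on ground set $\mathcal{H}$ $$\Delta(\mathcal{H}) = \{ H \subseteq \mathcal{H} : \text{there is an open } d\text{-dimensional simplex } \Delta \subset \mathbb{R}^d \text{ such that } H = \{h \in \mathcal{H} : h \cap \Delta \neq \emptyset\}\}.$$ For a set system $(X,\mathcal{R})$ and $Y \subseteq X$, $\mathcal{R}$ shatters $Y$ if $\{Y \cap R : R \in \mathcal{R}\}$ is the full power set of $Y$; $\operatorname{vcdim}(\mathcal{R})$ is the largest size of a subset of $X$ shattered by $\mathcal{R}$. Logarithms are base 2. *)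

theory Defs
  imports "HOL-Analysis.Analysis" "HOL-Library.Extended_Nat"
begin

text \<open>Points of R^d are represented as functions nat => real vanishing
  at all coordinates i >= d (the dimension d varies inside the statement).\<close>

definition Rd :: "nat \<Rightarrow> (nat \<Rightarrow> real) set" where
  "Rd d = {x. \<forall>i\<ge>d. x i = 0}"

definition hyperplane_in :: "nat \<Rightarrow> (nat \<Rightarrow> real) set \<Rightarrow> bool" where
  "hyperplane_in d h \<longleftrightarrow>
     (\<exists>a b. (\<exists>i<d. a i \<noteq> 0) \<and> h = {x \<in> Rd d. (\<Sum>i<d. a i * x i) = b})"

definition aff_indep_pts :: "nat \<Rightarrow> (nat \<Rightarrow> nat \<Rightarrow> real) \<Rightarrow> bool" where
  "aff_indep_pts d p \<longleftrightarrow>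
     (\<forall>\<mu> :: nat \<Rightarrow> real.
        (\<forall>i<d. (\<Sum>j\<in>{1..d}. \<mu> j * (p j i - p 0 i)) = 0) \<longrightarrow> (\<forall>j\<in>{1..d}. \<mu> j = 0))"

text \<open>Open d-dimensional simplex in R^d: the interior of the convex hull of
  d+1 affinely independent points, i.e. all strictly positive convex
  combinations of them.\<close>
definition open_simplex :: "nat \<Rightarrow> (nat \<Rightarrow> real) set \<Rightarrow> bool" where
  "open_simplex d S \<longleftrightarrow>
     (\<exists>p :: nat \<Rightarrow> nat \<Rightarrow> real.
        (\<forall>j\<le>d. p j \<in> Rd d) \<and> aff_indep_pts d p \<and>
        S = {x. \<exists>w :: nat \<Rightarrow> real. (\<forall>j\<le>d. w j > 0) \<and> (\<Sum>j\<le>d. w j) = 1 \<and>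
                  x = (\<lambda>i. \<Sum>j\<le>d. w j * p j i)})"

definition simplex_ranges ::
  "nat \<Rightarrow> (nat \<Rightarrow> real) set set \<Rightarrow> (nat \<Rightarrow> real) set set set" where
  "simplex_ranges d \<H> =
     {H. \<exists>S. open_simplex d S \<and> H = {h \<in> \<H>. h \<inter> S \<noteq> {}}}"

definition shatters :: "'a set set \<Rightarrow> 'a set \<Rightarrow> bool" where
  "shatters \<R> Y \<longleftrightarrow> (\<lambda>R. Y \<inter> R) ` \<R> = Pow Y"

definition vcdim :: "'a set \<Rightarrow> 'a set set \<Rightarrow> enat" where
  "vcdim X \<R> = Sup {enat (card Y) | Y. Y \<subseteq> X \<and> finite Y \<and> shatters \<R> Y}"

end

theory Submission
  imports Defs
begin

text \<open>If a finite set of hyperplanes is shattered as a whole, its cardinality is the dimension, so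
  a shattered family of the right size suffices. A simplex with a vertex at the origin misses the
  hyperplane \<open>a \<bullet> x = 1\<close> iff \<open>a \<bullet> p \<le> 1\<close> for its remaining vertices p, so dually we need about
  \<open>d\<^sup>2 log d\<close> points a, each subset of which is cut out by a union of at most d halfspaces
  \<open>a \<bullet> p > 1\<close>.

  In dimension 5, the \<open>L 2\<^bsup>L-1\<^esup>\<close> edges of the L-cube can be realised by points shattered by unions
  of \<open>2\<^sup>L\<close> halfspaces: a halfspace corresponds to a pair (x, z) of cube vertices and contains the edge
  at w in direction j iff x agrees with w up to j and z agrees with w from j on. Reading x and z as
  base 4 numbers u and v (most significant digit first for x, last for z), this says that (u, v)
  lies in an axis-parallel ellipse attached to the edge, which is linear in \<open>(u\<^sup>2, u, v\<^sup>2, v, 1)\<close>.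
  Placing about d/10 copies in orthogonal blocks of coordinates gains the remaining factor d, since
  one halfspace can be prescribed independently in every block.\<close>

section \<open>From simplices to unions of halfspaces\<close>

text \<open>The threshold 1 keeps the origin out of every halfspace, matching a simplex with a
  vertex at the origin. Points carry an index so that blocks can later be indexed by pairs.\<close>

definition halfspaces_shatter :: "nat \<Rightarrow> nat \<Rightarrow> 'e set \<Rightarrow> ('e \<Rightarrow> nat \<Rightarrow> real) \<Rightarrow> bool" where
  "halfspaces_shatter N k I a \<longleftrightarrow>
     (\<forall>B\<subseteq>I. \<exists>q :: nat \<Rightarrow> nat \<Rightarrow> real. \<forall>e\<in>I. e \<in> B \<longleftrightarrow> (\<exists>j<k. (\<Sum>i<N. a e i * q j i) > 1))"

lemma vcdim_eq_card:
  assumes "finite H" "shatters R H"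
  shows "vcdim H R = enat (card H)"
  unfolding vcdim_def
proof (rule antisym)
  show "Sup {enat (card Y) |Y. Y \<subseteq> H \<and> finite Y \<and> shatters R Y} \<le> enat (card H)"
    by (rule Sup_least) (use assms in \<open>auto intro: card_mono\<close>)
  show "enat (card H) \<le> Sup {enat (card Y) |Y. Y \<subseteq> H \<and> finite Y \<and> shatters R Y}"
    by (rule Sup_upper) (use assms in auto)
qed

text \<open>Start from uniform weights, with value \<open>avg\<close>, and shift mass towards vertex
  \<open>J\<close> if \<open>avg\<close> is at most 1 and towards vertex 0 otherwise. The shift
  stops short of the vertex, so all weights stay positive.\<close>

lemma ex_positive_weights:
  fixes s :: "nat \<Rightarrow> real"
  assumes "s 0 = 0" "J \<le> d" "s J > 1"
  shows "\<exists>w. (\<forall>j\<le>d. w j > 0) \<and> (\<Sum>j\<le>d. w j) = 1 \<and> (\<Sum>j\<le>d. w j * s j) = 1"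
proof -
  define avg where "avg = (\<Sum>j\<le>d. s j) / real (d + 1)"
  have "\<exists>t J'. 0 \<le> t \<and> t < 1 \<and> J' \<le> d \<and> (1 - t) * avg + t * s J' = 1"
  proof (cases "avg \<le> 1")
    case True
    let ?t = "(1 - avg) / (s J - avg)"
    have "0 \<le> ?t" "?t < 1" using True assms by (auto simp: divide_simps)
    moreover have "(1 - ?t) * avg + ?t * s J = avg + ?t * (s J - avg)"
      by (simp only: algebra_simps)
    moreover have "\<dots> = 1" using True assms by simp
    ultimately show ?thesis using assms(2) by metis
  next
    case False
    then show ?thesis using assms(1)
      by (intro exI[of _ "1 - 1 / avg"] exI[of _ 0]) (auto simp: field_simps)
  qed
  then obtain t J' where t: "0 \<le> t" "t < 1" "J' \<le> d" "(1 - t) * avg + t * s J' = 1" by blast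
  define w where "w j = (1 - t) / real (d + 1) + (if j = J' then t else 0)" for j
  have "w j > 0" for j using t by (auto simp: w_def intro: add_pos_nonneg)
  moreover have "(\<Sum>j\<le>d. w j) = 1"
  proof -
    have "(\<Sum>j\<le>d. w j) = real (d + 1) * ((1 - t) / real (d + 1)) + t"
      using t(3) by (simp add: w_def sum.distrib)
    then show ?thesis by simp
  qed
  moreover have "(\<Sum>j\<le>d. w j * s j) = 1"
  proof -
    have "(\<Sum>j\<le>d. w j * s j) =
        (\<Sum>j\<le>d. (1 - t) / real (d + 1) * s j + (if j = J' then t * s j else 0))"
      by (intro sum.cong refl) (auto simp: w_def algebra_simps)
    also have "\<dots> = (1 - t) * avg + t * s J'"
      using t(3) by (simp add: sum.distrib avg_def sum_distrib_left sum_divide_distrib)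
    finally show ?thesis using t(4) by simp
  qed
  ultimately show ?thesis by blast
qed

text \<open>A linear form that is 0 at the vertex at the origin takes the value 1 on the open
  simplex iff it exceeds 1 at some vertex. So \<open>k\<close> vertices can encode the halfspaces,
  and \<open>N\<close> more leave room for affine independence.\<close>

lemma ex_shattered_hyperplanes:
  fixes a :: "'e \<Rightarrow> nat \<Rightarrow> real"
  assumes "finite I" and Nk: "N + k \<le> d" and sh: "halfspaces_shatter N k I a"
  shows "\<exists>\<H>. (\<forall>h\<in>\<H>. hyperplane_in d h) \<and> vcdim \<H> (simplex_ranges d \<H>) = enat (card I)"
proof -
  define hp where "hp e = {x \<in> Rd d. (\<Sum>i<d. (if i < N then a e i else 0) * x i) = 1}" for e
  have dotN: "(\<Sum>i<d. (if i < N then a e i else 0) * x i) = (\<Sum>i<N. a e i * x i)" for e x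
    by (rule sum.mono_neutral_cong_right) (use Nk in auto)
  have hp: "hp e = {x \<in> Rd d. (\<Sum>i<N. a e i * x i) = 1}" for e
    unfolding hp_def dotN ..
  have simplex: "\<exists>S. open_simplex d S \<and> (\<forall>e\<in>I. e \<in> B \<longleftrightarrow> hp e \<inter> S \<noteq> {})" if "B \<subseteq> I" for B
  proof -
    obtain q where q: "\<forall>e\<in>I. e \<in> B \<longleftrightarrow> (\<exists>j<k. (\<Sum>i<N. a e i * q j i) > 1)"
      using sh \<open>B \<subseteq> I\<close> unfolding halfspaces_shatter_def by blast
    define T where "T = 1 + (\<Sum>e\<in>I. \<Sum>i<N. \<bar>a e i\<bar>)"
    have T: "T > 0" unfolding T_def by (intro add_pos_nonneg sum_nonneg) auto
    have aT: "a e i * (1 / T) \<le> 1" if "e \<in> I" "i < N" for e i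
    proof -
      have "\<bar>a e i\<bar> \<le> (\<Sum>i<N. \<bar>a e i\<bar>)" by (rule member_le_sum) (use that in auto)
      also have "\<dots> \<le> (\<Sum>e\<in>I. \<Sum>i<N. \<bar>a e i\<bar>)"
        by (rule member_le_sum) (use that \<open>finite I\<close> in \<open>auto intro: sum_nonneg\<close>)
      finally show ?thesis using T by (simp add: T_def field_simps)
    qed
    \<comment> \<open>The last d - N vertices carry the halfspaces in the coordinates below N and a unit vector in
       the others; the first N are so short that they are cut off by no hyperplane.\<close>
    define p :: "nat \<Rightarrow> nat \<Rightarrow> real" where
      "p j i = (if j = 0 then 0
         else if j \<le> N then (if i = j - 1 then 1 / T else 0)
         else if i < N then (if j - 1 - N < k then q (j - 1 - N) i else 0)
         else if i = j - 1 then 1 else 0)" for j i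
    define S where "S = {x. \<exists>w :: nat \<Rightarrow> real. (\<forall>j\<le>d. w j > 0) \<and> (\<Sum>j\<le>d. w j) = 1 \<and>
                  x = (\<lambda>i. \<Sum>j\<le>d. w j * p j i)}"
    have pRd: "p j \<in> Rd d" if "j \<le> d" for j
      using that Nk by (auto simp: Rd_def p_def)
    have "aff_indep_pts d p"
      unfolding aff_indep_pts_def
    proof (intro allI impI)
      fix \<mu> :: "nat \<Rightarrow> real"
      assume "\<forall>i<d. (\<Sum>j\<in>{1..d}. \<mu> j * (p j i - p 0 i)) = 0"
      then have z: "(\<Sum>j\<in>{1..d}. \<mu> j * p j i) = 0" if "i < d" for i
        using that by (simp add: p_def)
      \<comment> \<open>Coordinate \<open>j - 1\<close> is nonzero only at vertex \<open>j\<close>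
        when \<open>N < j\<close>, so these coefficients vanish first; the coordinates below
        \<open>N\<close> then see only the short vertices.\<close>
      have hi: "\<mu> j = 0" if "N < j" "j \<le> d" for j
      proof -
        have pj: "p j' (j - 1) = (if j' = j then 1 else 0)" if "j' \<ge> 1" for j'
        proof -
          have "j - 1 = j' - 1 \<longleftrightarrow> j' = j" using that \<open>N < j\<close> by linarith
          moreover have "\<not> j - 1 < N" using \<open>N < j\<close> by linarith
          ultimately show ?thesis using that \<open>N < j\<close> by (simp add: p_def)
        qed
        have "(\<Sum>j'\<in>{1..d}. \<mu> j' * p j' (j - 1)) = (\<Sum>j'\<in>{1..d}. if j' = j then \<mu> j else 0)"
          by (intro sum.cong refl) (use that pj in auto)
        then show ?thesis using z[of "j - 1"] that by simp
      qed
      have lo: "\<mu> j = 0" if "0 < j" "j \<le> N" for j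
      proof -
        have "(\<Sum>j'\<in>{1..d}. \<mu> j' * p j' (j - 1)) = (\<Sum>j'\<in>{1..d}. if j' = j then \<mu> j * (1 / T) else 0)"
        proof (intro sum.cong refl)
          fix j' assume j': "j' \<in> {1..d}"
          then have "j - 1 = j' - 1 \<longleftrightarrow> j' = j" using that by auto
          then show "\<mu> j' * p j' (j - 1) = (if j' = j then \<mu> j * (1 / T) else 0)"
            using that hi[of j'] j' by (cases "j' \<le> N") (auto simp: p_def)
        qed
        then show ?thesis using z[of "j - 1"] that T Nk by simp
      qed
      show "\<forall>j\<in>{1..d}. \<mu> j = 0" using hi lo by (metis atLeastAtMost_iff not_le less_eq_Suc_le One_nat_def)
    qed
    then have "open_simplex d S"
      unfolding open_simplex_def S_def using pRd by blast
    moreover have "e \<in> B \<longleftrightarrow> hp e \<inter> S \<noteq> {}" if e: "e \<in> I" for e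
    proof -
      define s where "s j = (\<Sum>i<N. a e i * p j i)" for j
      have s0: "s 0 = 0" by (simp add: s_def p_def)
      have lin: "(\<Sum>i<N. a e i * (\<Sum>j\<le>d. w j * p j i)) = (\<Sum>j\<le>d. w j * s j)" for w
        unfolding s_def sum_distrib_left
        by (subst sum.swap) (intro sum.cong refl, simp add: mult_ac)
      have slo: "s j \<le> 1" if "0 < j" "j \<le> N" for j
      proof -
        have "s j = (\<Sum>i<N. if i = j - 1 then a e i * (1 / T) else 0)"
          unfolding s_def by (intro sum.cong refl) (use that in \<open>auto simp: p_def\<close>)
        also have "\<dots> = a e (j - 1) * (1 / T)" using that by simp
        finally show ?thesis using aT[OF e, of "j - 1"] that by simp
      qed
      \<comment> \<open>Vertices left over after the \<open>k\<close> halfspaces get the value 0,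
        hence cause no unwanted intersection.\<close>
      have shi: "s (N + 1 + j) = (if j < k then \<Sum>i<N. a e i * q j i else 0)" for j
        unfolding s_def by (auto simp: p_def)
      have iff: "e \<in> B \<longleftrightarrow> (\<exists>j\<le>d. s j > 1)"
      proof
        assume "e \<in> B"
        then obtain j where "j < k" "(\<Sum>i<N. a e i * q j i) > 1" using q e by blast
        then show "\<exists>j\<le>d. s j > 1" using Nk shi[of j] by (intro exI[of _ "N + 1 + j"]) auto
      next
        assume "\<exists>j\<le>d. s j > 1"
        then obtain j where j: "s j > 1" by blast
        then have "N < j" using slo[of j] s0 by (cases "j = 0") (auto intro: ccontr)
        then obtain j' where "j = N + 1 + j'" by (auto simp: less_iff_Suc_add)
        then show "e \<in> B" using j shi[of j'] q e by (auto split: if_splits)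
      qed
      show ?thesis
      proof
        assume "e \<in> B"
        then obtain J where "J \<le> d" "s J > 1" using iff by blast
        then obtain w where w: "\<forall>j\<le>d. w j > 0" "(\<Sum>j\<le>d. w j) = 1" "(\<Sum>j\<le>d. w j * s j) = 1"
          using ex_positive_weights s0 by metis
        have "(\<lambda>i. \<Sum>j\<le>d. w j * p j i) \<in> hp e"
          unfolding hp using w(3) lin[of w] pRd by (auto simp: Rd_def)
        moreover have "(\<lambda>i. \<Sum>j\<le>d. w j * p j i) \<in> S" unfolding S_def using w by blast
        ultimately show "hp e \<inter> S \<noteq> {}" by blast
      next
        assume "hp e \<inter> S \<noteq> {}"
        then obtain w where w: "\<forall>j\<le>d. w j > 0" "(\<Sum>j\<le>d. w j) = 1" "(\<Sum>j\<le>d. w j * s j) = 1"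
          unfolding hp S_def using lin by auto
        show "e \<in> B"
        proof (rule ccontr)
          assume "e \<notin> B"
          then have le: "s j \<le> 1" if "j \<le> d" for j using iff that by force
          \<comment> \<open>The origin has positive weight and value 0, which pulls the average
            strictly below 1.\<close>
          have "(\<Sum>j\<le>d. w j * s j) < (\<Sum>j\<le>d. w j)"
          proof (rule sum_strict_mono_ex1)
            show "\<forall>j\<in>{..d}. w j * s j \<le> w j" using le w(1) by (auto intro: mult_left_le less_imp_le)
            show "\<exists>j\<in>{..d}. w j * s j < w j" using s0 w(1) by (intro bexI[of _ 0]) auto
          qed simp
          then show False using w by simp
        qed
      qed
    qed
    ultimately show ?thesis by blast
  qed
  \<comment> \<open>The simplex that selects \<open>e\<close> alone separates \<open>hp e\<close>
    from all others, so no element of \<open>I\<close> is lost in the count.\<close>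
  have inj: "inj_on hp I"
  proof (rule inj_onI)
    fix e f assume ef: "e \<in> I" "f \<in> I" "hp e = hp f"
    then obtain S where "\<forall>g\<in>I. g \<in> {e} \<longleftrightarrow> hp g \<inter> S \<noteq> {}" using simplex[of "{e}"] by blast
    then show "e = f" using ef by (metis singleton_iff)
  qed
  have "hyperplane_in d (hp e)" if e: "e \<in> I" for e
  proof -
    obtain q :: "nat \<Rightarrow> nat \<Rightarrow> real" and j where "(\<Sum>i<N. a e i * q j i) > 1"
      using sh e unfolding halfspaces_shatter_def by blast
    then have "\<exists>i<N. a e i \<noteq> 0" by (force intro: ccontr)
    then have "\<exists>i<d. (if i < N then a e i else 0) \<noteq> 0" using Nk by force
    then show ?thesis unfolding hyperplane_in_def hp_def
      by (intro exI[of _ "\<lambda>i. if i < N then a e i else 0"] exI[of _ 1]) auto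
  qed
  moreover have "shatters (simplex_ranges d (hp ` I)) (hp ` I)"
    unfolding shatters_def
  proof (intro equalityI subsetI)
    fix Y assume "Y \<in> Pow (hp ` I)"
    then obtain B where B: "B \<subseteq> I" "Y = hp ` B" by (auto simp: subset_image_iff)
    obtain S where S: "open_simplex d S" "\<forall>e\<in>I. e \<in> B \<longleftrightarrow> hp e \<inter> S \<noteq> {}"
      using simplex[OF B(1)] by blast
    have "Y = {h \<in> hp ` I. h \<inter> S \<noteq> {}}" using B S(2) by auto
    then have "Y \<in> simplex_ranges d (hp ` I)" unfolding simplex_ranges_def using S(1) by blast
    moreover have "Y = hp ` I \<inter> Y" using B by auto
    ultimately show "Y \<in> (\<inter>) (hp ` I) ` simplex_ranges d (hp ` I)" by blast
  qed auto
  then have "vcdim (hp ` I) (simplex_ranges d (hp ` I)) = enat (card I)"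
    using vcdim_eq_card[of "hp ` I"] \<open>finite I\<close> by (simp add: card_image[OF inj])
  ultimately show ?thesis by blast
qed

section \<open>Orthogonal blocks of coordinates\<close>

text \<open>A point of block \<open>b\<close> sees only the coordinates of that block, so the
  \<open>j\<close>-th halfspaces of all blocks concatenate into a single one. The number of points
  grows by the factor \<open>m\<close> while \<open>k\<close> stays the same.\<close>

lemma halfspaces_shatter_blocks:
  fixes a :: "'e \<Rightarrow> nat \<Rightarrow> real"
  assumes sh: "halfspaces_shatter N k I a"
  shows "halfspaces_shatter (m * N) k ({..<m} \<times> I)
    (\<lambda>(b, e) i. if i div N = b then a e (i mod N) else 0)"
  unfolding halfspaces_shatter_def
proof (intro allI impI)
  fix B assume "B \<subseteq> {..<m} \<times> I"
  have "\<forall>b. \<exists>q :: nat \<Rightarrow> nat \<Rightarrow> real. \<forall>e\<in>I. e \<in> {e \<in> I. (b, e) \<in> B} \<longleftrightarrow> (\<exists>j<k. (\<Sum>i<N. a e i * q j i) > 1)"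
  proof
    fix b
    have "{e \<in> I. (b, e) \<in> B} \<subseteq> I" by blast
    then show "\<exists>q :: nat \<Rightarrow> nat \<Rightarrow> real. \<forall>e\<in>I. e \<in> {e \<in> I. (b, e) \<in> B} \<longleftrightarrow>
        (\<exists>j<k. (\<Sum>i<N. a e i * q j i) > 1)"
      using sh unfolding halfspaces_shatter_def by blast
  qed
  from choice[OF this] obtain q :: "nat \<Rightarrow> nat \<Rightarrow> nat \<Rightarrow> real" where
    q: "\<And>b e. e \<in> I \<Longrightarrow> (b, e) \<in> B \<longleftrightarrow> (\<exists>j<k. (\<Sum>i<N. a e i * q b j i) > 1)"
    by auto
  have "(\<Sum>i<m * N. (if i div N = b then a e (i mod N) else 0) * q (i div N) j (i mod N))
      = (\<Sum>i<N. a e i * q b j i)" if "b < m" for b e j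
  proof (cases "N = 0")
    case False
    have "(\<Sum>i<m * N. (if i div N = b then a e (i mod N) else 0) * q (i div N) j (i mod N))
      = (\<Sum>i\<in>(\<lambda>i. b * N + i) ` {..<N}. a e (i mod N) * q b j (i mod N))"
    proof (rule sum.mono_neutral_cong_right)
      show "(\<lambda>i. b * N + i) ` {..<N} \<subseteq> {..<m * N}"
      proof clarsimp
        fix i assume "i < N"
        then have "b * N + i < Suc b * N" by simp
        also have "\<dots> \<le> m * N" using that by (intro mult_right_mono) auto
        finally show "b * N + i < m * N" .
      qed
      show "\<forall>i\<in>{..<m * N} - (\<lambda>i. b * N + i) ` {..<N}.
        (if i div N = b then a e (i mod N) else 0) * q (i div N) j (i mod N) = 0"
      proof
        fix i assume i: "i \<in> {..<m * N} - (\<lambda>i. b * N + i) ` {..<N}"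
        have "i = (i div N) * N + i mod N" "i mod N < N" using False by auto
        then have "i div N \<noteq> b" using i by (metis DiffD2 imageI lessThan_iff)
        then show "(if i div N = b then a e (i mod N) else 0) * q (i div N) j (i mod N) = 0" by simp
      qed
    qed auto
    also have "\<dots> = (\<Sum>i<N. a e i * q b j i)"
      by (subst sum.reindex) (auto simp: inj_on_def)
    finally show ?thesis .
  qed simp
  then show "\<exists>q :: nat \<Rightarrow> nat \<Rightarrow> real. \<forall>x\<in>{..<m} \<times> I. x \<in> B \<longleftrightarrow>
      (\<exists>j<k. (\<Sum>i<m * N. (case x of (b, e) \<Rightarrow> \<lambda>i. if i div N = b then a e (i mod N) else 0) i * q j i) > 1)"
    using q by (intro exI[of _ "\<lambda>j i. q (i div N) j (i mod N)"]) auto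
qed

section \<open>Prescribing edges of the cube\<close>

text \<open>Defines a set by well-founded recursion on membership. It serves both directions of the
  cube argument: upwards to get \<open>x\<close> from \<open>z\<close>, downwards to get
  \<open>z\<close> from \<open>x\<close>.\<close>

lemma wf_ex_set:
  assumes "wf r"
  shows "\<exists>x. \<forall>j. j \<in> x \<longleftrightarrow> F j (x \<inter> {i. (i, j) \<in> r})"
proof -
  define f where "f = wfrec r (\<lambda>f j. F j {i. (i, j) \<in> r \<and> f i})"
  have "f j \<longleftrightarrow> F j {i. (i, j) \<in> r \<and> cut f r j i}" for j
    unfolding f_def by (subst wfrec[OF assms]) simp
  moreover have "{i. (i, j) \<in> r \<and> cut f r j i} = Collect f \<inter> {i. (i, j) \<in> r}" for j
    by (auto simp: cut_def)
  ultimately show ?thesis by (metis mem_Collect_eq)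
qed

text \<open>The pair (j, w) is the edge of the cube of subsets of \<open>{..<L}\<close> in direction j whose lower end is w.
  Imposing \<open>j \<in> x \<longleftrightarrow> j \<in> z\<close> exactly for the prescribed edges determines x from z from low to high
  indices, and z from x from high to low.\<close>

lemma ex_cube_queries:
  fixes P :: "nat \<Rightarrow> nat set \<Rightarrow> bool"
  shows "\<exists>X. (\<forall>z. X z \<subseteq> {..<L}) \<and>
    (\<forall>j w. j < L \<longrightarrow> w \<subseteq> {..<L} \<longrightarrow> j \<notin> w \<longrightarrow>
      (P j w \<longleftrightarrow> (\<exists>z\<subseteq>{..<L}. X z \<inter> {..j} = w \<inter> {..j} \<and> z \<inter> {j..} = w \<inter> {j..})))"
proof -
  \<comment> \<open>The only edge in direction \<open>j\<close> that the pair (x, z) can contain has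
    as lower end \<open>x\<close> below \<open>j\<close> joined with \<open>z\<close> above
    \<open>j\<close>; it is contained iff \<open>j\<close> lies in neither set.\<close>
  have "\<forall>z. \<exists>x. \<forall>j. j \<in> x \<longleftrightarrow> j < L \<and> ((j \<in> z) = P j (x \<inter> {..<j} \<union> z \<inter> {j<..}))"
  proof
    fix z
    have "{i. (i, j) \<in> less_than} = {..<j}" for j by auto
    then show "\<exists>x. \<forall>j. j \<in> x \<longleftrightarrow> j < L \<and> ((j \<in> z) = P j (x \<inter> {..<j} \<union> z \<inter> {j<..}))"
      using wf_ex_set[OF wf_less_than, of "\<lambda>j y. j < L \<and> ((j \<in> z) = P j (y \<union> z \<inter> {j<..}))"] by simp
  qed
  then obtain X where X: "\<And>z j. j \<in> X z \<longleftrightarrow> j < L \<and> ((j \<in> z) = P j (X z \<inter> {..<j} \<union> z \<inter> {j<..}))"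
    by metis
  have "P j w \<longleftrightarrow> (\<exists>z\<subseteq>{..<L}. X z \<inter> {..j} = w \<inter> {..j} \<and> z \<inter> {j..} = w \<inter> {j..})"
    if j: "j < L" "w \<subseteq> {..<L}" "j \<notin> w" for j w
  proof
    assume Pw: "P j w"
    let ?r = "{(i, j). j < i \<and> i < L}"
    have "wf ?r" by (rule wf_subset[OF wf_measure[of "\<lambda>i. L - i"]]) auto
    \<comment> \<open>From \<open>j\<close> on, \<open>z0\<close> copies \<open>w\<close>; below
      \<open>j\<close>, going downwards, it is chosen so that \<open>X z0\<close> will reproduce
      \<open>w\<close>.\<close>
    then obtain z0 where z0: "\<And>i. i \<in> z0 \<longleftrightarrow>
        (if i < j then (i \<in> w) = P i (w \<inter> {..<i} \<union> (z0 \<inter> {i'. (i', i) \<in> ?r})) else i \<in> w)"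
      using wf_ex_set[of ?r "\<lambda>i y. if i < j then (i \<in> w) = P i (w \<inter> {..<i} \<union> y) else i \<in> w"]
      by blast
    have zL: "z0 \<subseteq> {..<L}"
    proof
      fix i assume "i \<in> z0"
      then show "i \<in> {..<L}" using z0[of i] j by (cases "i < j") auto
    qed
    then have "z0 \<inter> {i'. (i', i) \<in> ?r} = z0 \<inter> {i<..}" for i by auto
    note z = z0[unfolded this]
    \<comment> \<open>Both recursions compare with the same truth value of \<open>P i\<close>, and
      comparing twice cancels.\<close>
    have step: "i \<in> X z0 \<longleftrightarrow> i \<in> w" if i: "i < j" "X z0 \<inter> {..<i} = w \<inter> {..<i}" for i
    proof -
      have "i < L" using i j by simp
      then show ?thesis using X[of i z0] z[of i] i by metis
    qed
    have agree: "i \<le> j \<Longrightarrow> X z0 \<inter> {..<i} = w \<inter> {..<i}" for i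
    proof (induction i)
      case (Suc i)
      then have "X z0 \<inter> {..<i} = w \<inter> {..<i}" "i \<in> X z0 \<longleftrightarrow> i \<in> w" using step[of i] by auto
      then show ?case unfolding lessThan_Suc by blast
    qed simp
    have "i \<in> z0 \<longleftrightarrow> i \<in> w" if "j \<le> i" for i using z[of i] that by simp
    then have hi: "z0 \<inter> {j..} = w \<inter> {j..}" by blast
    then have "z0 \<inter> {j<..} = w \<inter> {j<..}" "j \<notin> z0" using j by (auto simp: set_eq_iff)
    moreover have "w \<inter> {..<j} \<union> w \<inter> {j<..} = w" using j(3) by (auto simp: neq_iff) (metis linorder_neqE_nat)
    ultimately have "j \<notin> X z0" using X[of j z0] agree[of j] Pw by (metis order_refl)
    then have "X z0 \<inter> {..j} = w \<inter> {..j}" using agree[of j] j(3)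
      unfolding lessThan_Suc_atMost[symmetric] lessThan_Suc by blast
    then show "\<exists>z\<subseteq>{..<L}. X z \<inter> {..j} = w \<inter> {..j} \<and> z \<inter> {j..} = w \<inter> {j..}" using hi zL by blast
  next
    assume "\<exists>z\<subseteq>{..<L}. X z \<inter> {..j} = w \<inter> {..j} \<and> z \<inter> {j..} = w \<inter> {j..}"
    then obtain z where z: "X z \<inter> {..j} = w \<inter> {..j}" "z \<inter> {j..} = w \<inter> {j..}" by blast
    then have n: "j \<notin> X z" "j \<notin> z" using j by auto
    have "X z \<inter> {..<j} = w \<inter> {..<j}" "z \<inter> {j<..} = w \<inter> {j<..}"
      using z by (auto simp: set_eq_iff)
    moreover have "w \<inter> {..<j} \<union> w \<inter> {j<..} = w" using j(3) by (auto simp: neq_iff) (metis linorder_neqE_nat)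
    ultimately have "X z \<inter> {..<j} \<union> z \<inter> {j<..} = w" by simp
    \<comment> \<open>With \<open>j\<close> in neither set, the equivalence that defines
      \<open>X z\<close> at \<open>j\<close> can only hold if \<open>P j w\<close> is true.\<close>
    then show "P j w" using X[of j z] n j(1) by simp
  qed
  moreover have "X z \<subseteq> {..<L}" for z using X by auto
  ultimately show ?thesis by blast
qed

section \<open>Base 4 codes of sets\<close>

text \<open>Using only the digits 0 and 1 in base 4 leaves a gap: codes of sets agreeing from
  \<open>j\<close> on are closer than \<open>4 ^ j / 3\<close>, all others are more than twice as
  far apart. In base 2 there would be no such gap.\<close>

definition code4 :: "nat set \<Rightarrow> real" where
  "code4 s = (\<Sum>i\<in>s. 4 ^ i)"

lemma code4_split:
  assumes "finite s"
  shows "code4 s = code4 (s \<inter> {..<j}) + code4 (s \<inter> {j..})"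
  unfolding code4_def
  by (subst sum.union_disjoint[symmetric]) (use assms in \<open>auto intro!: sum.cong\<close>)

lemma code4_nonneg: "code4 s \<ge> 0"
  unfolding code4_def by (auto intro: sum_nonneg)

lemma code4_less: "3 * code4 (s \<inter> {..<j}) < 4 ^ j"
proof -
  have "3 * (\<Sum>i<j. (4::real) ^ i) < 4 ^ j" by (induction j) auto
  moreover have "code4 (s \<inter> {..<j}) \<le> (\<Sum>i<j. 4 ^ i)"
    unfolding code4_def by (rule sum_mono2) auto
  ultimately show ?thesis by linarith
qed

lemma code4_close:
  assumes "finite s" "finite t" "s \<inter> {j..} = t \<inter> {j..}"
  shows "3 * \<bar>code4 s - code4 t\<bar> < 4 ^ j"
  using code4_split[OF assms(1), of j] code4_split[OF assms(2), of j] assms(3)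
    code4_less[of s j] code4_less[of t j] code4_nonneg[of "s \<inter> {..<j}"] code4_nonneg[of "t \<inter> {..<j}"]
  by (simp add: abs_if)

text \<open>The largest index \<open>M\<close> of disagreement contributes \<open>4 ^ M\<close>, of
  which the lower digits take back less than a third; and \<open>M\<close> is at least
  \<open>j\<close>.\<close>

lemma code4_far:
  assumes fin: "finite s" "finite t" and ne: "s \<inter> {j..} \<noteq> t \<inter> {j..}"
  shows "3 * \<bar>code4 s - code4 t\<bar> > 2 * 4 ^ j"
proof -
  define D where "D = ((s - t) \<union> (t - s)) \<inter> {j..}"
  define M where "M = Max D"
  have D: "finite D" "D \<noteq> {}" using fin ne by (auto simp: D_def)
  then have M: "M \<in> D" unfolding M_def by simp
  have above: "i \<in> s \<longleftrightarrow> i \<in> t" if "M < i" for i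
  proof (rule ccontr)
    assume "\<not> ?thesis"
    then have "i \<in> D" using that M by (auto simp: D_def)
    then show False using D(1) that unfolding M_def by (meson Max_ge not_le)
  qed
  have main: "3 * (code4 s - code4 t) > 2 * 4 ^ M"
    if "finite s" "finite t" "M \<in> s" "M \<notin> t" "\<And>i. M < i \<Longrightarrow> i \<in> s \<longleftrightarrow> i \<in> t" for s t
  proof -
    have "s \<inter> {M..} = insert M (t \<inter> {M..})"
    proof (rule set_eqI)
      fix i show "i \<in> s \<inter> {M..} \<longleftrightarrow> i \<in> insert M (t \<inter> {M..})"
        using that(3,4) that(5)[of i] by (cases i M rule: linorder_cases) auto
    qed
    then have "code4 (s \<inter> {M..}) = 4 ^ M + code4 (t \<inter> {M..})"
      using that(2,4) by (simp add: code4_def)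
    then show ?thesis
      using code4_split[OF that(1), of M] code4_split[OF that(2), of M]
        code4_less[of t M] code4_nonneg[of "s \<inter> {..<M}"] by simp
  qed
  have "(4::real) ^ j \<le> 4 ^ M" using M by (intro power_increasing) (auto simp: D_def)
  moreover have "3 * \<bar>code4 s - code4 t\<bar> > 2 * 4 ^ M"
  proof (cases "M \<in> s")
    case True
    then have "M \<notin> t" using M by (auto simp: D_def)
    then have "3 * (code4 s - code4 t) > 2 * 4 ^ M" using main[OF fin True] above by blast
    then show ?thesis using abs_ge_self[of "code4 s - code4 t"] by argo
  next
    case False
    then have "M \<in> t" using M by (auto simp: D_def)
    then have "3 * (code4 t - code4 s) > 2 * 4 ^ M" using main[OF fin(2,1) _ False] above by blast
    then show ?thesis using abs_ge_minus_self[of "code4 s - code4 t"] by argo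
  qed
  ultimately show ?thesis by linarith
qed

section \<open>The edges of the cube as points in dimension five\<close>

text \<open>Each cube vertex \<open>z\<close> supplies one halfspace, that of the pair
  \<open>(X z, z)\<close>, hence the number \<open>2 ^ L\<close>.\<close>

lemma halfspaces_shatter_cube:
  "\<exists>a. halfspaces_shatter 5 (2 ^ L) (SIGMA j:{..<L}. Pow ({..<L} - {j})) a"
proof -
  let ?I = "SIGMA j:{..<L}. Pow ({..<L} - {j})"
  \<comment> \<open>Index reversal turns agreement up to \<open>j\<close> into agreement from
    \<open>L - 1 - j\<close> on, the form that the codes detect.\<close>
  define \<rho> where "\<rho> s = (\<lambda>i. L - 1 - i) ` s" for s :: "nat set"
  \<comment> \<open>With this scaling a close pair contributes less than 4/9 and a far pair more
    than 16/9, so the sum of two contributions is below 1 iff both pairs are close.\<close>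
  define \<alpha> where "\<alpha> j = (2 / 4 ^ j :: real)\<^sup>2" for j :: nat
  define F where "F u v j w = \<alpha> (L - 1 - j) * (u - code4 (\<rho> w))\<^sup>2 + \<alpha> j * (v - code4 w)\<^sup>2"
    for u v j w
  \<comment> \<open>These are the coefficients of \<open>2 - F\<close> in the monomials of
    \<open>u\<close> and \<open>v\<close>; the 2 turns \<open>F < 1\<close> into a value above
    1.\<close>
  define a where "a = (\<lambda>(j, w) i.
     [- \<alpha> (L - 1 - j), 2 * \<alpha> (L - 1 - j) * code4 (\<rho> w), - \<alpha> j, 2 * \<alpha> j * code4 w,
      2 - \<alpha> (L - 1 - j) * (code4 (\<rho> w))\<^sup>2 - \<alpha> j * (code4 w)\<^sup>2] ! i)"
  have aF: "(\<Sum>i<5. a (j, w) i * [u\<^sup>2, u, v\<^sup>2, v, 1] ! i) = 2 - F u v j w" for j w u v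
    by (simp add: a_def F_def numeral_eq_Suc power2_eq_square algebra_simps)
  have \<alpha>_nonneg: "\<alpha> j \<ge> 0" for j by (simp add: \<alpha>_def)
  have close: "\<alpha> j * (code4 s - code4 t)\<^sup>2 < 1 / 2"
    if "finite s" "finite t" "s \<inter> {j..} = t \<inter> {j..}" for j s t
  proof -
    have "\<bar>2 / 4 ^ j * (code4 s - code4 t)\<bar> < 2 / 3"
      unfolding abs_mult using code4_close[OF that] by (simp add: divide_simps)
    then have "\<bar>2 / 4 ^ j * (code4 s - code4 t)\<bar>\<^sup>2 < (2 / 3)\<^sup>2"
      by (intro power_strict_mono) auto
    then have "\<alpha> j * (code4 s - code4 t)\<^sup>2 < (2 / 3)\<^sup>2"
      unfolding \<alpha>_def power2_abs power_mult_distrib .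
    moreover have "(2 / 3 :: real)\<^sup>2 < 1 / 2" by (simp add: power2_eq_square)
    ultimately show ?thesis by linarith
  qed
  have far: "\<alpha> j * (code4 s - code4 t)\<^sup>2 > 1"
    if "finite s" "finite t" "s \<inter> {j..} \<noteq> t \<inter> {j..}" for j s t
  proof -
    have "\<bar>2 / 4 ^ j * (code4 s - code4 t)\<bar> > 4 / 3"
      unfolding abs_mult using code4_far[OF that] by (simp add: divide_simps)
    then have "\<bar>2 / 4 ^ j * (code4 s - code4 t)\<bar>\<^sup>2 > (4 / 3)\<^sup>2"
      by (intro power_strict_mono) auto
    then have "\<alpha> j * (code4 s - code4 t)\<^sup>2 > (4 / 3)\<^sup>2"
      unfolding \<alpha>_def power2_abs power_mult_distrib .
    moreover have "(4 / 3 :: real)\<^sup>2 > 1" by (simp add: power2_eq_square)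
    ultimately show ?thesis by linarith
  qed
  have hit: "F (code4 (\<rho> x)) (code4 z) j w < 1 \<longleftrightarrow> x \<inter> {..j} = w \<inter> {..j} \<and> z \<inter> {j..} = w \<inter> {j..}"
    if "x \<subseteq> {..<L}" "z \<subseteq> {..<L}" "w \<subseteq> {..<L}" "j < L" for x z w j
  proof -
    have fin: "finite x" "finite z" "finite w" using that by (auto intro: finite_subset)
    then have fin': "finite (\<rho> x)" "finite (\<rho> w)" by (auto simp: \<rho>_def)
    have \<rho>: "\<rho> s \<inter> {L - 1 - j..} = \<rho> (s \<inter> {..j})" if "s \<subseteq> {..<L}" for s
      using that \<open>j < L\<close> by (force simp: \<rho>_def)
    have "inj_on (\<lambda>i. L - 1 - i) {..<L}" by (auto simp: inj_on_def)
    then have "\<rho> (x \<inter> {..j}) = \<rho> (w \<inter> {..j}) \<longleftrightarrow> x \<inter> {..j} = w \<inter> {..j}"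
      unfolding \<rho>_def by (rule inj_on_image_eq_iff) (use that in auto)
    then have x: "\<rho> x \<inter> {L - 1 - j..} = \<rho> w \<inter> {L - 1 - j..} \<longleftrightarrow> x \<inter> {..j} = w \<inter> {..j}"
      using \<rho> that by simp
    have nonneg: "\<alpha> i * (u - v)\<^sup>2 \<ge> 0" for i u v using \<alpha>_nonneg by simp
    show ?thesis unfolding F_def x[symmetric]
      using close[OF fin', of "L - 1 - j"] far[OF fin', of "L - 1 - j"]
        close[OF fin(2,3), of j] far[OF fin(2,3), of j]
        nonneg[of "L - 1 - j" "code4 (\<rho> x)" "code4 (\<rho> w)"] nonneg[of j "code4 z" "code4 w"]
      by argo
  qed
  obtain zs where zs: "bij_betw zs {..<(2::nat) ^ L} (Pow {..<L})"
    using ex_bij_betw_nat_finite[of "Pow {..<L}"] by (auto simp: card_Pow atLeast0LessThan)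
  have "halfspaces_shatter 5 (2 ^ L) ?I a"
    unfolding halfspaces_shatter_def
  proof (intro allI impI)
    fix B assume "B \<subseteq> ?I"
    obtain X where XL: "\<And>z. X z \<subseteq> {..<L}" and X: "\<And>j w. j < L \<Longrightarrow> w \<subseteq> {..<L} \<Longrightarrow> j \<notin> w \<Longrightarrow>
      (j, w) \<in> B \<longleftrightarrow> (\<exists>z\<subseteq>{..<L}. X z \<inter> {..j} = w \<inter> {..j} \<and> z \<inter> {j..} = w \<inter> {j..})"
      using ex_cube_queries[of L "\<lambda>j w. (j, w) \<in> B"] by metis
    define q :: "nat \<Rightarrow> nat \<Rightarrow> real" where
      "q l = (!) [(code4 (\<rho> (X (zs l))))\<^sup>2, code4 (\<rho> (X (zs l))), (code4 (zs l))\<^sup>2, code4 (zs l), 1]" for l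
    have "(j, w) \<in> B \<longleftrightarrow> (\<exists>l<2 ^ L. (\<Sum>i<5. a (j, w) i * q l i) > 1)" if "(j, w) \<in> ?I" for j w
    proof -
      have jw: "j < L" "w \<subseteq> {..<L}" "j \<notin> w" using that by auto
      have "(j, w) \<in> B \<longleftrightarrow> (\<exists>z\<in>Pow {..<L}. F (code4 (\<rho> (X z))) (code4 z) j w < 1)"
        unfolding X[OF jw] Bex_def Pow_iff
        by (intro arg_cong[where f = Ex] ext conj_cong refl hit[OF XL _ jw(2,1), symmetric])
      also have "\<dots> \<longleftrightarrow> (\<exists>l<2 ^ L. F (code4 (\<rho> (X (zs l)))) (code4 (zs l)) j w < 1)"
        unfolding bij_betw_imp_surj_on[OF zs, symmetric] by (simp add: Bex_def)
      also have "\<dots> \<longleftrightarrow> (\<exists>l<2 ^ L. (\<Sum>i<5. a (j, w) i * q l i) > 1)"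
        unfolding q_def aF by (simp add: less_diff_eq)
      finally show ?thesis .
    qed
    then have "e \<in> B \<longleftrightarrow> (\<exists>j<2 ^ L. (\<Sum>i<5. a e i * q j i) > 1)" if "e \<in> ?I" for e
      using that by (cases e) (simp only:)
    then show "\<exists>q :: nat \<Rightarrow> nat \<Rightarrow> real. \<forall>e\<in>?I. e \<in> B \<longleftrightarrow> (\<exists>j<2 ^ L. (\<Sum>i<5. a e i * q j i) > 1)"
      by (intro exI[of _ q] ballI)
  qed
  then show ?thesis by blast
qed

section \<open>Choice of parameters and the bounds\<close>

text \<open>Covers the dimensions below 10, where \<open>d div 10\<close> would leave no
  block.\<close>

lemma halfspaces_shatter_singleton: "halfspaces_shatter 1 1 {()} (\<lambda>_ _. 1)"
  unfolding halfspaces_shatter_def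
proof (intro allI impI)
  fix B :: "unit set"
  show "\<exists>q :: nat \<Rightarrow> nat \<Rightarrow> real. \<forall>e\<in>{()}. e \<in> B \<longleftrightarrow> (\<exists>j<1. (\<Sum>i<1. 1 * q j i) > 1)"
    by (intro exI[of _ "\<lambda>_ _. if () \<in> B then 2 else 0"]) auto
qed

theorem theorem2:
  shows "\<exists>c C :: real. c > 0 \<and> C > 0 \<and>
    (\<forall>d::nat. d \<ge> 4 \<longrightarrow>
      (\<exists>\<H>. (\<forall>h\<in>\<H>. hyperplane_in d h) \<and>
        (\<exists>k::nat. vcdim \<H> (simplex_ranges d \<H>) = enat k \<and>
           c * (real d)\<^sup>2 * log 2 (real d) \<le> real k \<and>
           real k \<le> C * (real d)\<^sup>2 * log 2 (real d))))"
proof -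
  have "\<exists>\<H>. (\<forall>h\<in>\<H>. hyperplane_in d h) \<and>
        (\<exists>k::nat. vcdim \<H> (simplex_ranges d \<H>) = enat k \<and>
           1 / 480 * (real d)\<^sup>2 * log 2 (real d) \<le> real k \<and>
           real k \<le> 1 * (real d)\<^sup>2 * log 2 (real d))" if d: "d \<ge> 4" for d :: nat
  proof (cases "d < 10")
    case True
    have l2: "2 \<le> log 2 (real d)" using d by (subst le_log_iff) auto
    have l4: "log 2 (real d) \<le> 4" using d True by (subst log_le_iff) auto
    have d2: "16 \<le> (real d)\<^sup>2" "(real d)\<^sup>2 \<le> 100"
      using power_mono[of 4 "real d" 2] power_mono[of "real d" 10 2] d True by auto
    \<comment> \<open>Here \<open>d\<^sup>2 log d\<close> lies between 32 and 400, so one hyperplane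
      satisfies both bounds.\<close>
    have "(real d)\<^sup>2 * log 2 (real d) \<le> 100 * 4" using d2 l4 l2 by (intro mult_mono) auto
    moreover have "16 * 2 \<le> (real d)\<^sup>2 * log 2 (real d)" using d2 l2 by (intro mult_mono) auto
    moreover obtain \<H> where "\<forall>h\<in>\<H>. hyperplane_in d h" "vcdim \<H> (simplex_ranges d \<H>) = enat 1"
      using ex_shattered_hyperplanes[OF _ _ halfspaces_shatter_singleton, of d] d by auto
    ultimately show ?thesis by (intro exI[of _ \<H>]) auto
  next
    case False
    define lg where "lg = log 2 (real d)"
    \<comment> \<open>This puts \<open>2 ^ L\<close> between d/4 and d/2. With \<open>m\<close>
      blocks of 5 coordinates taking at most the other half, everything fits into dimension
      \<open>d\<close>.\<close>
    define L where "L = nat \<lfloor>lg\<rfloor> - 1"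
    define m where "m = d div 10"
    have lg3: "3 \<le> lg" unfolding lg_def using False by (subst le_log_iff) auto
    have L: "real L \<le> lg - 1" "lg - 2 \<le> real L" using lg3 unfolding L_def by linarith+
    have "2 powr lg = real d" unfolding lg_def using d by simp
    then have dL: "2 * 2 ^ L \<le> real d" "real d \<le> 4 * 2 ^ L"
      using powr_mono[OF L(1), of 2] powr_mono[OF L(2), of 2]
      by (auto simp: powr_diff powr_realpow)
    have m: "10 * real m \<le> real d" "real d \<le> 20 * real m"
    proof -
      have "10 * m \<le> d" "d \<le> 20 * m" using False unfolding m_def by presburger+
      then show "10 * real m \<le> real d" "real d \<le> 20 * real m" by linarith+
    qed
    let ?J = "SIGMA j:{..<L}. Pow ({..<L} - {j})"
    obtain a where a: "halfspaces_shatter 5 (2 ^ L) ?J a" using halfspaces_shatter_cube by blast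
    have "real (m * 5 + 2 ^ L) \<le> real d" using dL m by simp
    then have Nk: "m * 5 + 2 ^ L \<le> d" by (simp only: of_nat_le_iff)
    obtain \<H> where H: "\<forall>h\<in>\<H>. hyperplane_in d h"
      "vcdim \<H> (simplex_ranges d \<H>) = enat (card ({..<m} \<times> ?J))"
      using ex_shattered_hyperplanes[OF _ Nk halfspaces_shatter_blocks[OF a]] by auto
    have "L \<ge> 1" using L lg3 by linarith
    have "card (Pow ({..<L} - {j})) = 2 ^ (L - 1)" if "j < L" for j
      using that by (simp add: card_Pow)
    then have "card ({..<m} \<times> ?J) = m * (L * 2 ^ (L - 1))"
      unfolding card_cartesian_product by (subst card_SigmaI) auto
    moreover have "real (2 ^ (L - 1)) = 2 ^ L / 2"
      using \<open>L \<ge> 1\<close> by (cases L) auto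
    ultimately have card: "real (card ({..<m} \<times> ?J)) = real m * (real L * (2 ^ L / 2))"
      by (simp only: of_nat_mult)
    \<comment> \<open>Since \<open>lg\<close> is at least 3, \<open>lg - 2\<close> is at least
      \<open>lg / 3\<close>. The factors 20, 3 and 8 multiply to 480.\<close>
    have "real d / 20 * (lg / 3 * (real d / 8)) \<le> real m * (real L * (2 ^ L / 2))"
      using m dL L lg3 by (intro mult_mono) auto
    moreover have "real m * (real L * (2 ^ L / 2)) \<le> real d * (lg * real d)"
      using m dL L lg3 by (intro mult_mono) auto
    ultimately have "1 / 480 * (real d)\<^sup>2 * log 2 (real d) \<le> real (card ({..<m} \<times> ?J))"
      "real (card ({..<m} \<times> ?J)) \<le> 1 * (real d)\<^sup>2 * log 2 (real d)"
      unfolding card lg_def by (simp_all add: power2_eq_square algebra_simps)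
    then show ?thesis using H by blast
  qed
  then show ?thesis by (intro exI[of _ "1 / 480"] exI[of _ 1]) auto
qed

end
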